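(* Let $F$ be an AM-space and let $X_F$ be the set of all vector lattice homomorphisms $F\to\mathbb{R}$, endowed with the bounded weak* topology (inherited from $F^*$). Then $F$, embedded by evaluation $f(x):=x(f)$ ($f\in F$, $x\in X_F$), is a regular sublattice of $C(X_F)$.
   Context: An AM-space is a norm complete normed lattice (real vector lattice with a solid norm) such that $\|e\vee f\|=\max(\|e\|,\|f\|)$ for all $e,f\ge 0$. The bounded weak* topology on the dual $F^*$ is the strongest topology which agrees with the weak* topology on the norm bounded subsets of $F^*$. $C(X_F)$ is the vector lattice of all real continuous functions on $X_F$ with pointwise operations. Evaluation identifies $F$ (as a vector lattice) with $C_{\mathrm{ph}}(X_F)$, the sublattice of $C(X_F)$ consisting of continuous functions $f$ with $f(tx)=tf(x)$ for all $x\in X_F$, $t\ge 0$. A sublattice $E$ of a vector lattice $G$ is regular if whenever $P\subset E$ has infimum $0$ in $E$, it has infimum $0$ in $G$. *)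

theory Defs
  imports "HOL-Analysis.Analysis" "HOL-Library.Function_Algebras"
    "HOL-Library.Lattice_Algebras" "HOL-Library.Lub_Glb"
begin

section \<open>Vector lattices\<close>

text \<open>
  A (real) vector lattice is a type of sort \<open>{ordered_real_vector, lattice}\<close>. Real functions
  on any type form one under the pointwise operations; the library already provides the pointwise
  addition, order and lattice operations.
\<close>

instantiation "fun" :: (type, real_vector) real_vector
begin

definition scaleR_fun :: "real \<Rightarrow> ('a \<Rightarrow> 'b) \<Rightarrow> 'a \<Rightarrow> 'b"
  where "scaleR_fun c f = (\<lambda>x. c *\<^sub>R f x)"

instance
  by standard (auto simp: scaleR_fun_def fun_eq_iff algebra_simps)

end

instance "fun" :: (type, ordered_real_vector) ordered_real_vector
  by standard (auto simp: scaleR_fun_def le_fun_def intro: scaleR_left_mono scaleR_right_mono)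

definition vector_lattice_hom ::
    "('a::{ordered_real_vector,lattice} \<Rightarrow> 'b::{ordered_real_vector,lattice}) \<Rightarrow> bool" where
  "vector_lattice_hom h \<longleftrightarrow> linear h \<and>
     (\<forall>f g. h (sup f g) = sup (h f) (h g)) \<and> (\<forall>f g. h (inf f g) = inf (h f) (h g))"

definition vector_sublattice :: "'v::{ordered_real_vector,lattice} set \<Rightarrow> bool" where
  "vector_sublattice E \<longleftrightarrow> subspace E \<and> (\<forall>f\<in>E. \<forall>g\<in>E. sup f g \<in> E \<and> inf f g \<in> E)"

text \<open>
  Below, \<open>E\<close> and \<open>G\<close> are vector sublattices of one ambient vector lattice, and \<open>isGlb E P z\<close> says
  that \<open>z\<close> is the infimum of \<open>P\<close> computed in \<open>E\<close>. Infima are taken of nonempty sets only: in the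
  degenerate case \<open>E = {0}\<close> the empty set would have infimum \<open>0\<close> in \<open>E\<close>, and in no larger \<open>G\<close>.
\<close>

definition regular_sublattice ::
    "'v::{ordered_real_vector,lattice} set \<Rightarrow> 'v set \<Rightarrow> bool" where
  "regular_sublattice E G \<longleftrightarrow> E \<subseteq> G \<and> vector_sublattice E \<and>
     (\<forall>P. P \<subseteq> E \<longrightarrow> P \<noteq> {} \<longrightarrow> isGlb E P 0 \<longrightarrow> isGlb G P 0)"

definition real_continuous_functions :: "('x::topological_space \<Rightarrow> real) set" where
  "real_continuous_functions = {g. continuous_on UNIV g}"

lemma vector_sublattice_real_continuous_functions:
  "vector_sublattice (real_continuous_functions :: ('x::topological_space \<Rightarrow> real) set)"
  unfolding vector_sublattice_def real_continuous_functions_def subspace_def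
  by (auto simp: plus_fun_def zero_fun_def scaleR_fun_def sup_fun_def inf_fun_def
        sup_max inf_min intro!: continuous_intros)


section \<open>AM-spaces\<close>

text \<open>The class \<open>lattice_ab_group_add_abs\<close> supplies the modulus \<open>\<bar>x\<bar> = sup x (- x)\<close>.\<close>

class am_space = banach + ordered_real_vector + lattice_ab_group_add_abs +
  assumes norm_solid: "\<bar>x\<bar> \<le> \<bar>y\<bar> \<Longrightarrow> norm x \<le> norm y"
    and norm_sup_eq_max: "0 \<le> x \<Longrightarrow> 0 \<le> y \<Longrightarrow> norm (sup x y) = max (norm x) (norm y)"


section \<open>The bounded weak* topology\<close>

text \<open>
  On a dual space \<open>'a \<Rightarrow>\<^sub>L real\<close> the strong operator topology is the topology of pointwise
  convergence, i.e.\ the weak* topology.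
\<close>

abbreviation weak_star_topology :: "('a::real_normed_vector \<Rightarrow>\<^sub>L real) topology" where
  "weak_star_topology \<equiv> strong_operator_topology"

definition agrees_weak_star_on_bounded ::
    "('a::real_normed_vector \<Rightarrow>\<^sub>L real) topology \<Rightarrow> bool" where
  "agrees_weak_star_on_bounded T \<longleftrightarrow>
     (\<forall>B. bounded B \<longrightarrow> subtopology T B = subtopology weak_star_topology B)"

definition bounded_weak_star_topology :: "('a::real_normed_vector \<Rightarrow>\<^sub>L real) topology" where
  "bounded_weak_star_topology =
     (THE T. agrees_weak_star_on_bounded T \<and>
        (\<forall>T'. agrees_weak_star_on_bounded T' \<longrightarrow> (\<forall>U. openin T' U \<longrightarrow> openin T U)))"

lemma bounded_weak_star_topology_aux:
  fixes T :: "('a::real_normed_vector \<Rightarrow>\<^sub>L real) topology"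
  defines "T \<equiv> topology (\<lambda>U. \<forall>B. bounded B \<longrightarrow>
                  openin (subtopology weak_star_topology B) (U \<inter> B))"
  shows "openin T U \<longleftrightarrow>
           (\<forall>B. bounded B \<longrightarrow> openin (subtopology weak_star_topology B) (U \<inter> B))"
    and "agrees_weak_star_on_bounded T"
    and "agrees_weak_star_on_bounded T' \<Longrightarrow> openin T' U \<Longrightarrow> openin T U"
proof -
  let ?W = "weak_star_topology :: ('a \<Rightarrow>\<^sub>L real) topology"
  have "istopology (\<lambda>U. \<forall>B. bounded B \<longrightarrow> openin (subtopology ?W B) (U \<inter> B))"
    unfolding istopology_def
  proof (intro conjI allI impI)
    fix S S' and B :: "('a \<Rightarrow>\<^sub>L real) set"
    assume "\<forall>B. bounded B \<longrightarrow> openin (subtopology ?W B) (S \<inter> B)"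
      "\<forall>B. bounded B \<longrightarrow> openin (subtopology ?W B) (S' \<inter> B)" "bounded B"
    then have "openin (subtopology ?W B) ((S \<inter> B) \<inter> (S' \<inter> B))"
      by (meson openin_Int)
    moreover have "(S \<inter> B) \<inter> (S' \<inter> B) = S \<inter> S' \<inter> B" by blast
    ultimately show "openin (subtopology ?W B) (S \<inter> S' \<inter> B)" by simp
  next
    fix K and B :: "('a \<Rightarrow>\<^sub>L real) set"
    assume K: "\<forall>S\<in>K. \<forall>B. bounded B \<longrightarrow> openin (subtopology ?W B) (S \<inter> B)" "bounded B"
    then have "openin (subtopology ?W B) (\<Union>S\<in>K. S \<inter> B)"
      by (intro openin_Union) auto
    then show "openin (subtopology ?W B) (\<Union>K \<inter> B)"
      by (simp only: Int_Union2)
  qed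
  then have op: "openin T V \<longleftrightarrow> (\<forall>B. bounded B \<longrightarrow> openin (subtopology ?W B) (V \<inter> B))" for V
    unfolding T_def by (simp add: topology_inverse')
  then show "openin T U \<longleftrightarrow> (\<forall>B. bounded B \<longrightarrow> openin (subtopology ?W B) (U \<inter> B))" .
  show "agrees_weak_star_on_bounded T"
    unfolding agrees_weak_star_on_bounded_def topology_eq
  proof (intro allI impI iffI)
    fix B V assume B: "bounded B" and "openin (subtopology T B) V"
    then show "openin (subtopology ?W B) V"
      by (auto simp: openin_subtopology[of T] op)
  next
    fix B V assume B: "bounded B" and "openin (subtopology ?W B) V"
    then obtain S where S: "openin ?W S" "V = S \<inter> B"
      by (auto simp: openin_subtopology)
    then have "openin T S"
      unfolding op openin_subtopology by blast
    then show "openin (subtopology T B) V"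
      using S(2) by (auto simp: openin_subtopology)
  qed
  show "openin T U" if T': "agrees_weak_star_on_bounded T'" and U: "openin T' U"
    unfolding op
  proof (intro allI impI)
    fix B :: "('a \<Rightarrow>\<^sub>L real) set" assume "bounded B"
    then have "subtopology T' B = subtopology ?W B"
      using T' by (simp add: agrees_weak_star_on_bounded_def)
    then show "openin (subtopology ?W B) (U \<inter> B)"
      using U by (metis openin_subtopology)
  qed
qed

lemma
  shows agrees_bounded_weak_star_topology:
      "agrees_weak_star_on_bounded
        (bounded_weak_star_topology :: ('a::real_normed_vector \<Rightarrow>\<^sub>L real) topology)"
    and bounded_weak_star_topology_strongest:
      "\<And>T' (U :: ('a \<Rightarrow>\<^sub>L real) set). agrees_weak_star_on_bounded T' \<Longrightarrow> openin T' U \<Longrightarrow>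
        openin bounded_weak_star_topology U"
    and openin_bounded_weak_star_topology:
      "\<And>U :: ('a \<Rightarrow>\<^sub>L real) set. openin bounded_weak_star_topology U \<longleftrightarrow>
         (\<forall>B. bounded B \<longrightarrow> openin (subtopology weak_star_topology B) (U \<inter> B))"
proof -
  define T :: "('a \<Rightarrow>\<^sub>L real) topology" where "T = topology (\<lambda>U. \<forall>B. bounded B \<longrightarrow>
                  openin (subtopology weak_star_topology B) (U \<inter> B))"
  note aux = bounded_weak_star_topology_aux[where 'a = 'a, folded T_def]
  have "bounded_weak_star_topology = T"
    unfolding bounded_weak_star_topology_def
  proof (rule the_equality)
    show "agrees_weak_star_on_bounded T \<and>
        (\<forall>T'. agrees_weak_star_on_bounded T' \<longrightarrow> (\<forall>U. openin T' U \<longrightarrow> openin T U))"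
      using aux by blast
  next
    fix S :: "('a \<Rightarrow>\<^sub>L real) topology"
    assume "agrees_weak_star_on_bounded S \<and>
        (\<forall>T'. agrees_weak_star_on_bounded T' \<longrightarrow> (\<forall>U. openin T' U \<longrightarrow> openin S U))"
    then show "S = T"
      unfolding topology_eq using aux(2,3) by blast
  qed
  then show "agrees_weak_star_on_bounded
      (bounded_weak_star_topology :: ('a \<Rightarrow>\<^sub>L real) topology)"
    "\<And>T' (U :: ('a \<Rightarrow>\<^sub>L real) set). agrees_weak_star_on_bounded T' \<Longrightarrow> openin T' U \<Longrightarrow>
        openin bounded_weak_star_topology U"
    "\<And>U :: ('a \<Rightarrow>\<^sub>L real) set. openin bounded_weak_star_topology U \<longleftrightarrow>
         (\<forall>B. bounded B \<longrightarrow> openin (subtopology weak_star_topology B) (U \<inter> B))"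
    using aux by auto
qed


section \<open>The space of real vector lattice homomorphisms\<close>

text \<open>
  The homomorphisms are taken inside the dual space, where the topology lives. By automatic
  continuity this is no restriction, see \<open>range_apply_hom_space\<close> below.
\<close>

typedef (overloaded) 'a hom_space =
    "{x :: 'a::am_space \<Rightarrow>\<^sub>L real. vector_lattice_hom (blinfun_apply x)}"
  morphisms dual_of_hom hom_of_dual
  by (rule exI[of _ 0]) (simp add: vector_lattice_hom_def linear_iff)

instantiation hom_space :: (am_space) topological_space
begin

definition open_hom_space :: "'a hom_space set \<Rightarrow> bool" where
  "open_hom_space U \<longleftrightarrow> openin (pullback_topology UNIV dual_of_hom bounded_weak_star_topology) U"

instance
proof
  have "openin bounded_weak_star_topology (UNIV :: ('a \<Rightarrow>\<^sub>L real) set)"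
    using openin_topspace[of weak_star_topology]
    by (auto simp: openin_bounded_weak_star_topology openin_subtopology
        strong_operator_topology_topspace)
  then show "open (UNIV :: 'a hom_space set)"
    unfolding open_hom_space_def openin_pullback_topology by (intro exI[of _ UNIV]) simp
qed (auto simp: open_hom_space_def)

end

definition hom_eval :: "'a::am_space \<Rightarrow> 'a hom_space \<Rightarrow> real" where
  "hom_eval f = (\<lambda>x. blinfun_apply (dual_of_hom x) f)"

lemma am_space_nonneg_limit:
  fixes X :: "nat \<Rightarrow> 'a::am_space"
  assumes X: "X \<longlonglongrightarrow> l" and nonneg: "\<And>n. n \<ge> N \<Longrightarrow> 0 \<le> X n"
  shows "0 \<le> l"
proof -
  have le: "norm (nprt l) \<le> norm (X n - l)" if "n \<ge> N" for n
  proof (rule norm_solid)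
    have "- l \<le> X n - l" using nonneg[OF that] by simp
    also have "\<dots> \<le> \<bar>X n - l\<bar>" by (rule abs_ge_self)
    finally have "- nprt l \<le> \<bar>X n - l\<bar>"
      by (simp add: nprt_def neg_inf_eq_sup)
    then show "\<bar>nprt l\<bar> \<le> \<bar>X n - l\<bar>"
      by (metis abs_of_nonpos nprt_le_zero)
  qed
  have "(\<lambda>n. norm (X n - l)) \<longlonglongrightarrow> 0"
    using X by (simp add: LIM_zero tendsto_norm_zero)
  then have "norm (nprt l) \<le> 0"
    by (rule LIMSEQ_le_const) (use le in blast)
  then show ?thesis
    by (simp add: zero_le_iff_zero_nprt)
qed

lemma vector_lattice_hom_bounded_linear:
  fixes h :: "'a::am_space \<Rightarrow> real"
  assumes "vector_lattice_hom h"
  shows "bounded_linear h"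
proof -
  have lin: "linear h" and hsup: "\<And>f g. h (sup f g) = sup (h f) (h g)"
    using assms by (auto simp: vector_lattice_hom_def)
  interpret linear h by (fact lin)
  have pos: "0 \<le> h a" if "0 \<le> a" for a
    using hsup[of a 0] that by (simp add: sup_absorb1 zero sup_max max_def split: if_splits)
  have mono: "h a \<le> h b" if "a \<le> b" for a b
    using pos[of "b - a"] that by (simp add: diff)
  have habs: "h \<bar>a\<bar> = \<bar>h a\<bar>" for a
    by (simp add: abs_lattice hsup neg sup_max)
  have "\<exists>K. \<forall>x\<ge>0. h x \<le> K * norm x"
  proof (rule ccontr)
    assume "\<not> ?thesis"
    then have "\<forall>n::nat. \<exists>x\<ge>0. h x > 4 ^ n * norm x"
      by (meson not_le)
    then obtain x where x: "\<And>n::nat. 0 \<le> x n" "\<And>n. h (x n) > 4 ^ n * norm (x n)"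
      by metis
    have nz: "norm (x n) > 0" for n
      using x(2)[of n] zero by (cases "x n = 0") auto
    define y where "y n = (1 / (2 ^ n * norm (x n))) *\<^sub>R x n" for n
    have y0: "0 \<le> y n" for n
      unfolding y_def by (intro scaleR_nonneg_nonneg) (auto simp: x)
    have ny: "norm (y n) = (1/2) ^ n" for n
      using nz[of n] by (simp add: y_def power_divide)
    have hy: "h (y n) \<ge> 2 ^ n" for n
    proof -
      have "(2::real) ^ n * 2 ^ n = 4 ^ n"
        by (simp flip: power_mult_distrib)
      then have "2 ^ n * (2 ^ n * norm (x n)) \<le> h (x n)"
        using x(2)[of n] by (metis less_imp_le mult.assoc)
      then show ?thesis
        using nz[of n] by (simp add: y_def scale pos_le_divide_eq)
    qed
    have "summable (\<lambda>n. norm (y n))"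
      unfolding ny by (rule summable_geometric) simp
    then have "summable y" by (rule summable_norm_cancel)
    then have lim: "(\<lambda>m. \<Sum>i<m. y i) \<longlonglongrightarrow> suminf y" by (rule summable_LIMSEQ)
    have "y n \<le> suminf y" for n
    proof -
      have "(\<lambda>m. (\<Sum>i<m. y i) - y n) \<longlonglongrightarrow> suminf y - y n"
        by (intro tendsto_intros lim)
      moreover have "0 \<le> (\<Sum>i<m. y i) - y n" if "m \<ge> Suc n" for m
      proof -
        have "y n = (\<Sum>i\<in>{n}. y i)" by simp
        also have "\<dots> \<le> (\<Sum>i<m. y i)"
          using that by (intro sum_mono2) (auto simp: y0)
        finally show ?thesis by simp
      qed
      ultimately have "0 \<le> suminf y - y n" by (rule am_space_nonneg_limit)
      then show ?thesis by simp
    qed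
    then have "2 ^ n \<le> h (suminf y)" for n
      using hy[of n] mono[of "y n" "suminf y"] by (meson order_trans)
    moreover obtain n where "h (suminf y) < 2 ^ n"
      using real_arch_pow[of 2 "h (suminf y)"] by auto
    ultimately show False
      by (meson not_le)
  qed
  then obtain K where K: "\<And>x. 0 \<le> x \<Longrightarrow> h x \<le> K * norm x" by blast
  have "norm (h x) \<le> norm x * K" for x
  proof -
    have "norm \<bar>x\<bar> = norm x"
      by (intro antisym norm_solid) auto
    then show ?thesis
      using K[of "\<bar>x\<bar>"] by (simp add: habs mult.commute)
  qed
  then show ?thesis
    using lin by (auto simp: bounded_linear_def bounded_linear_axioms_def)
qed

lemma range_apply_hom_space:
  "range (\<lambda>x. blinfun_apply (dual_of_hom x)) = {h :: 'a::am_space \<Rightarrow> real. vector_lattice_hom h}"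
proof (intro set_eqI iffI)
  fix h :: "'a \<Rightarrow> real" assume "h \<in> {h. vector_lattice_hom h}"
  then have h: "vector_lattice_hom h" by simp
  then have "blinfun_apply (Blinfun h) = h"
    by (simp add: bounded_linear_Blinfun_apply vector_lattice_hom_bounded_linear)
  then have "h = blinfun_apply (dual_of_hom (hom_of_dual (Blinfun h)))"
    using h by (simp add: hom_of_dual_inverse)
  then show "h \<in> range (\<lambda>x. blinfun_apply (dual_of_hom x))" by blast
qed (use dual_of_hom in auto)

end

theory Submission
  imports Defs
begin

text \<open>
  Lattice homomorphisms separate the points of an AM-space: \<open>u \<mapsto> \<parallel>u\<^sup>+\<parallel>\<close> is a sublinear
  functional that preserves binary suprema, and a minimal such functional is linear, because the
  usual Hahn-Banach modification \<open>inf\<^sub>t (q (u + t w) - t q w)\<close> again preserves suprema.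

  For regularity, suppose that a continuous \<open>g\<close> lies below \<open>P\<close> but is positive at \<open>y\<close>. By the argument
  of Banach and Dieudonne, \<open>g\<close> exceeds some \<open>\<epsilon> > 0\<close> at all \<open>x\<close> with \<open>\<bar>x a - y a\<bar> \<le> 1\<close> for all \<open>a\<close> in a
  union of finite sets \<open>A\<^sub>n\<close> of vectors of norm at most \<open>1/n\<^sup>2\<close>. Let \<open>y e = 1\<close>, \<open>e \<ge> 0\<close>, and let \<open>s\<close> be the sum
  over \<open>n\<close> of the suprema of \<open>\<bar>a - y a e\<bar>\<close>, \<open>a \<in> A\<^sub>n\<close>, which converges because the norm of a finite
  supremum is a maximum of norms. Then \<open>f = (e - s)\<^sup>+\<close> satisfies \<open>y f = 1\<close>, and \<open>x f > 0\<close> forces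
  \<open>x / x e\<close> into the neighbourhood above, so that \<open>\<epsilon> f \<le> p\<close> for all \<open>p \<in> P\<close> by homogeneity.
\<close>

section \<open>Sublinear functionals preserving suprema\<close>

text \<open>This class interpolates between sublinear functionals and lattice homomorphisms: its
  linear members are lattice homomorphisms, yet it is stable under the Hahn-Banach modification and
  under infima of nonempty chains below a fixed member, as Zorn's lemma requires.\<close>

definition sublinear_sup_hom :: "('a::{ordered_real_vector,lattice_ab_group_add} \<Rightarrow> real) \<Rightarrow> bool"
  where "sublinear_sup_hom q \<longleftrightarrow> (\<forall>u v. q (u + v) \<le> q u + q v) \<and>
    (\<forall>c>0. \<forall>u. q (c *\<^sub>R u) = c * q u) \<and> (\<forall>u v. q (sup u v) = max (q u) (q v))"

lemma sublinear_sup_homD: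
  assumes "sublinear_sup_hom q"
  shows "q (u + v) \<le> q u + q v" "c > 0 \<Longrightarrow> q (c *\<^sub>R u) = c * q u"
    "q (sup u v) = max (q u) (q v)"
  using assms by (auto simp: sublinear_sup_hom_def)

lemma sublinear_sup_hom_0:
  assumes "sublinear_sup_hom q"
  shows "q 0 = 0"
  using sublinear_sup_homD(2)[OF assms, of 2 0] by simp

lemma sublinear_sup_hom_scaleR_nonneg:
  assumes "sublinear_sup_hom q" "c \<ge> 0"
  shows "q (c *\<^sub>R u) = c * q u"
  using assms sublinear_sup_homD(2)[OF assms(1), of c u] sublinear_sup_hom_0[OF assms(1)]
  by (cases "c = 0") auto

text \<open>Applied to some \<open>p \<le> q\<close> in the class, this gives
  \<open>- q (- u) \<le> p u\<close>, so pointwise infima over families below \<open>q\<close> are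
  finite.\<close>

lemma sublinear_sup_hom_minus_ge:
  assumes "sublinear_sup_hom q"
  shows "- q (- u) \<le> q u"
  using sublinear_sup_homD(1)[OF assms, of u "- u"] sublinear_sup_hom_0[OF assms] by simp

text \<open>Serves to show that certain infima of subadditive functionals are subadditive. The two
  infima on the right are reached by letting one index vary at a time.\<close>

lemma cINF_add_ge:
  fixes f g h :: "'i \<Rightarrow> real"
  assumes "I \<noteq> {}" "bdd_below (f ` I)"
    and dir: "\<And>s t. s \<in> I \<Longrightarrow> t \<in> I \<Longrightarrow> \<exists>r\<in>I. f r \<le> g s + h t"
  shows "(INF r\<in>I. f r) \<le> (INF s\<in>I. g s) + (INF t\<in>I. h t)"
proof -
  have le: "(INF r\<in>I. f r) \<le> g s + h t" if "s \<in> I" "t \<in> I" for s t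
    using dir[OF that] cINF_lower[OF assms(2)] by (meson order_trans)
  have "(INF r\<in>I. f r) - g s \<le> (INF t\<in>I. h t)" if "s \<in> I" for s
    using le[OF that] by (intro cINF_greatest[OF assms(1)]) (simp add: algebra_simps)
  then have "(INF r\<in>I. f r) - (INF t\<in>I. h t) \<le> (INF s\<in>I. g s)"
    by (intro cINF_greatest[OF assms(1)]) (simp add: algebra_simps)
  then show ?thesis by simp
qed

text \<open>An infimum need not commute with \<open>max\<close>; here directedness supplies one
  index that is nearly optimal for both families at once.\<close>

lemma cINF_max_directed:
  fixes f g :: "'i \<Rightarrow> real"
  assumes "I \<noteq> {}" "bdd_below (f ` I)" "bdd_below (g ` I)"
    and dir: "\<And>s t. s \<in> I \<Longrightarrow> t \<in> I \<Longrightarrow> \<exists>r\<in>I. f r \<le> f s \<and> g r \<le> g t"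
  shows "(INF r\<in>I. max (f r) (g r)) = max (INF r\<in>I. f r) (INF r\<in>I. g r)"
proof (rule antisym)
  have bdd: "bdd_below ((\<lambda>r. max (f r) (g r)) ` I)"
    using assms(2) unfolding bdd_below_def by (auto simp: le_max_iff_disj)
  show "(INF r\<in>I. max (f r) (g r)) \<le> max (INF r\<in>I. f r) (INF r\<in>I. g r)"
  proof (rule ccontr)
    assume "\<not> ?thesis"
    then have "(INF r\<in>I. f r) < (INF r\<in>I. max (f r) (g r))" "(INF r\<in>I. g r) < (INF r\<in>I. max (f r) (g r))"
      by auto
    then obtain s t where st: "s \<in> I" "t \<in> I" "f s < (INF r\<in>I. max (f r) (g r))"
        "g t < (INF r\<in>I. max (f r) (g r))"
      using cINF_less_iff[OF assms(1,2)] cINF_less_iff[OF assms(1,3)] by blast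
    then obtain r where "r \<in> I" "f r \<le> f s" "g r \<le> g t" using dir by blast
    then show False
      using st cINF_lower[OF bdd \<open>r \<in> I\<close>] by auto
  qed
  show "max (INF r\<in>I. f r) (INF r\<in>I. g r) \<le> (INF r\<in>I. max (f r) (g r))"
    using cINF_lower[OF assms(2)] cINF_lower[OF assms(3)]
    by (intro cINF_greatest[OF assms(1)]) (auto simp: max.coboundedI1 max.coboundedI2 intro!: max.mono)
qed

text \<open>The value at \<open>- w\<close> drops to \<open>- q w\<close>, so a minimal functional
  must coincide with its own modification and be odd. Suprema survive because translation commutes
  with \<open>sup\<close> and \<open>\<phi> u t\<close> decreases in \<open>t\<close>, which makes
  the family directed.\<close>

lemma sublinear_sup_hom_tilt:
  fixes q :: "'a::{ordered_real_vector,lattice_ab_group_add} \<Rightarrow> real"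
  assumes q: "sublinear_sup_hom q"
  obtains q' where "sublinear_sup_hom q'" "q' \<le> q" "q' (- w) \<le> - q w"
proof -
  note qD = sublinear_sup_homD[OF q] and q0 = sublinear_sup_hom_0[OF q]
    and qscale = sublinear_sup_hom_scaleR_nonneg[OF q]
  define \<phi> where "\<phi> u t = q (u + t *\<^sub>R w) - t * q w" for u t
  define q' where "q' u = (INF t\<in>{0..}. \<phi> u t)" for u
  have bdd: "bdd_below (\<phi> u ` {0..})" for u
  proof (rule bdd_belowI2)
    fix t :: real assume "t \<in> {0..}"
    \<comment> \<open>Subadditivity for \<open>t *\<^sub>R w = (u + t *\<^sub>R w) + (- u)\<close>
      gives a bound that does not depend on \<open>t\<close>.\<close>
    then show "- q (- u) \<le> \<phi> u t"
      using qD(1)[of "u + t *\<^sub>R w" "- u"] qscale[of t w] by (simp add: \<phi>_def)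
  qed
  have ne: "{0::real..} \<noteq> {}" by auto
  have anti: "\<phi> u t \<le> \<phi> u s" if "s \<le> t" for u s t
  proof -
    have "q (u + t *\<^sub>R w) = q ((u + s *\<^sub>R w) + (t - s) *\<^sub>R w)"
      by (simp add: algebra_simps)
    also have "\<dots> \<le> q (u + s *\<^sub>R w) + (t - s) * q w"
      using qD(1) qscale[of "t - s" w] that by (metis diff_ge_0_iff_ge)
    finally show ?thesis by (simp add: \<phi>_def algebra_simps)
  qed
  have low: "q' u \<le> \<phi> u t" if "t \<ge> 0" for u t
    unfolding q'_def using that by (intro cINF_lower[OF bdd]) auto
  show thesis
  proof
    show "q' \<le> q"
      using low[of 0] by (simp add: le_fun_def \<phi>_def)
    show "q' (- w) \<le> - q w"
      using low[of 1 "- w"] by (simp add: \<phi>_def q0)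
    show "sublinear_sup_hom q'"
      unfolding sublinear_sup_hom_def
    proof (intro conjI allI impI)
      fix u v
      show "q' (u + v) \<le> q' u + q' v"
        unfolding q'_def
      proof (rule cINF_add_ge[OF ne bdd])
        fix s t :: real assume st: "s \<in> {0..}" "t \<in> {0..}"
        have "\<phi> (u + v) (s + t) \<le> \<phi> u s + \<phi> v t"
          using qD(1)[of "u + s *\<^sub>R w" "v + t *\<^sub>R w"] by (simp add: \<phi>_def algebra_simps)
        then show "\<exists>r\<in>{0..}. \<phi> (u + v) r \<le> \<phi> u s + \<phi> v t"
          using st by (intro bexI[of _ "s + t"]) auto
      qed
      have "\<phi> (sup u v) t = max (\<phi> u t) (\<phi> v t)" for t
        unfolding \<phi>_def add_sup_distrib_right qD(3) by auto
      then show "q' (sup u v) = max (q' u) (q' v)"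
        unfolding q'_def
        by (simp, intro cINF_max_directed bdd ne) (meson anti max.cobounded1 max.cobounded2 atLeast_iff max.coboundedI1)
    next
      fix c :: real and u assume c: "c > 0"
      \<comment> \<open>One inequality for all positive factors is enough, since at
        \<open>inverse c\<close> it is the converse one. It comes from reparametrising the infimum
        by \<open>c * t\<close>.\<close>
      have le: "q' (c *\<^sub>R u) \<le> c * q' u" if "c > 0" for c u
      proof -
        have "q' (c *\<^sub>R u) / c \<le> \<phi> u t" if "t \<in> {0..}" for t
        proof -
          have "\<phi> (c *\<^sub>R u) (c * t) = c * \<phi> u t"
            using qD(2)[OF \<open>c > 0\<close>, of "u + t *\<^sub>R w"] by (simp add: \<phi>_def algebra_simps)
          then show ?thesis
            using low[of "c * t" "c *\<^sub>R u"] that \<open>c > 0\<close> by (simp add: field_simps)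
        qed
        then have "q' (c *\<^sub>R u) / c \<le> q' u"
          unfolding q'_def[of u] by (intro cINF_greatest[OF ne])
        then show ?thesis using that by (simp add: field_simps)
      qed
      show "q' (c *\<^sub>R u) = c * q' u"
        using le[OF c, of u] le[of "inverse c" "c *\<^sub>R u"] c by (simp add: field_simps)
    qed
  qed
qed

text \<open>Zorn's lemma gives a minimal \<open>m\<close>. Oddness, forced by the tilt, turns
  subadditivity into additivity and preservation of suprema into preservation of infima.\<close>

lemma vector_lattice_hom_below_sublinear:
  fixes q :: "'a::{ordered_real_vector,lattice_ab_group_add} \<Rightarrow> real"
  assumes q: "sublinear_sup_hom q"
  obtains h where "vector_lattice_hom h" "h \<le> q"
proof -
  define A where "A = {p. sublinear_sup_hom p \<and> p \<le> q}"
  have "\<exists>m\<in>A. \<forall>a\<in>A. a \<le> m \<longrightarrow> a = m"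
  proof (rule predicate_Zorn)
    show "partial_order_on A (relation_of (\<lambda>x y. y \<le> x) A)"
      by (rule partial_order_on_relation_ofI) auto
    fix C assume C: "C \<in> Chains (relation_of (\<lambda>x y. y \<le> x) A)"
    show "\<exists>u\<in>A. \<forall>a\<in>C. u \<le> a"
    \<comment> \<open>The infimum over an empty chain carries no information, so \<open>q\<close>
      itself serves as its lower bound.\<close>
    proof (cases "C = {}")
      case True
      then show ?thesis using q by (auto simp: A_def)
    next
      case ne: False
      have CA: "C \<subseteq> A" using C by (auto simp: Chains_def relation_of_def)
      have tot: "a \<le> b \<or> b \<le> a" if "a \<in> C" "b \<in> C" for a b
        using C that by (auto simp: Chains_def relation_of_def)
      have bdd: "bdd_below ((\<lambda>p. p u) ` C)" for u
      proof (rule bdd_belowI2)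
        fix p assume "p \<in> C"
        then have "sublinear_sup_hom p" "p \<le> q" using CA by (auto simp: A_def)
        then show "- q (- u) \<le> p u"
          using sublinear_sup_hom_minus_ge[of p u] le_funD[of p q "- u"] by simp
      qed
      define m where "m u = (INF p\<in>C. p u)" for u
      have lower: "m \<le> p" if "p \<in> C" for p
        unfolding le_fun_def m_def using cINF_lower[OF bdd that] by simp
      have dir: "\<exists>r\<in>C. r \<le> a \<and> r \<le> b" if "a \<in> C" "b \<in> C" for a b
        using tot[OF that] that by blast
      have "m \<in> A"
        unfolding A_def sublinear_sup_hom_def
      proof (intro CollectI conjI allI impI)
        fix u v
        show "m (u + v) \<le> m u + m v"
          unfolding m_def
        proof (rule cINF_add_ge[OF ne bdd])
          fix a b assume "a \<in> C" "b \<in> C"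
          then obtain r where r: "r \<in> C" "r \<le> a" "r \<le> b" using dir by blast
          then have "r (u + v) \<le> r u + r v"
            using CA sublinear_sup_homD(1) by (auto simp: A_def)
          then show "\<exists>r\<in>C. r (u + v) \<le> a u + b v"
            using r le_funD[of r a u] le_funD[of r b v] by (intro bexI[of _ r]) auto
        qed
        have "p (sup u v) = max (p u) (p v)" if "p \<in> C" for p
          using that CA sublinear_sup_homD(3) by (auto simp: A_def)
        then have "m (sup u v) = (INF p\<in>C. max (p u) (p v))"
          unfolding m_def by (intro INF_cong) auto
        also have "\<dots> = max (m u) (m v)"
          unfolding m_def by (intro cINF_max_directed ne bdd) (meson dir le_funD)
        finally show "m (sup u v) = max (m u) (m v)" .
      next
        fix c :: real and u assume c: "c > 0"
        have sc: "p (c *\<^sub>R u) = c * p u" if "p \<in> C" for p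
          using that CA sublinear_sup_homD(2)[of p c] c by (auto simp: A_def)
        show "m (c *\<^sub>R u) = c * m u"
        proof (rule antisym)
          have "m (c *\<^sub>R u) / c \<le> p u" if "p \<in> C" for p
            using le_funD[OF lower[OF that], of "c *\<^sub>R u"] sc[OF that] c by (simp add: field_simps)
          then have "m (c *\<^sub>R u) / c \<le> m u"
            unfolding m_def[of u] by (intro cINF_greatest[OF ne])
          then show "m (c *\<^sub>R u) \<le> c * m u" using c by (simp add: field_simps)
          show "c * m u \<le> m (c *\<^sub>R u)"
            unfolding m_def[of "c *\<^sub>R u"]
          proof (rule cINF_greatest[OF ne])
            fix p assume "p \<in> C"
            then show "c * m u \<le> p (c *\<^sub>R u)"
              using mult_left_mono[OF le_funD[OF lower], of p c u] sc c by simp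
          qed
        qed
      next
        show "m \<le> q"
          using ne lower CA by (fastforce simp: A_def)
      qed
      then show ?thesis using lower by blast
    qed
  qed
  then obtain m where m: "sublinear_sup_hom m" "m \<le> q"
    and min: "\<And>a. sublinear_sup_hom a \<Longrightarrow> a \<le> q \<Longrightarrow> a \<le> m \<Longrightarrow> a = m"
    by (auto simp: A_def)
  note mD = sublinear_sup_homD[OF m(1)]
  have neg: "m (- u) = - m u" for u
  proof (rule antisym)
    \<comment> \<open>The tilt along \<open>u\<close> lies below \<open>m\<close>, so minimality
      identifies the two.\<close>
    obtain m' where "sublinear_sup_hom m'" "m' \<le> m" "m' (- u) \<le> - m u"
      using sublinear_sup_hom_tilt[OF m(1)] by blast
    moreover have "m' = m"
      using calculation m(2) by (intro min) auto
    ultimately show "m (- u) \<le> - m u" by simp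
    show "- m u \<le> m (- u)"
      using sublinear_sup_hom_minus_ge[OF m(1), of u] by simp
  qed
  have "linear m"
  proof (rule linearI)
    fix u v
    show "m (u + v) = m u + m v"
      using mD(1)[of u v] mD(1)[of "u + v" "- v"] by (simp add: neg)
  next
    fix c :: real and u
    show "m (c *\<^sub>R u) = c *\<^sub>R m u"
    proof (cases "c \<ge> 0")
      case True
      then show ?thesis using sublinear_sup_hom_scaleR_nonneg[OF m(1)] by simp
    next
      case False
      then show ?thesis
        using sublinear_sup_hom_scaleR_nonneg[OF m(1), of "- c" u] neg[of "c *\<^sub>R u"] by simp
    qed
  qed
  moreover have "m (inf u v) = inf (m u) (m v)" for u v
    using mD(3)[of "- u" "- v"] neg[of "inf u v"] by (simp add: neg neg_inf_eq_sup inf_min)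
  ultimately have "vector_lattice_hom m"
    by (simp add: vector_lattice_hom_def mD(3) sup_max)
  with m(2) show thesis by (rule that[rotated])
qed

text \<open>A homomorphism below the tilt satisfies \<open>h (- w) \<le> - q w\<close>, that is,
  \<open>q w \<le> h w\<close>.\<close>

lemma vector_lattice_hom_below_sublinear_attaining:
  fixes q :: "'a::{ordered_real_vector,lattice_ab_group_add} \<Rightarrow> real"
  assumes "sublinear_sup_hom q"
  obtains h where "vector_lattice_hom h" "h \<le> q" "h w = q w"
proof -
  obtain q' where q': "sublinear_sup_hom q'" "q' \<le> q" "q' (- w) \<le> - q w"
    using sublinear_sup_hom_tilt[OF assms] by blast
  obtain h where h: "vector_lattice_hom h" "h \<le> q'"
    using vector_lattice_hom_below_sublinear[OF q'(1)] by blast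
  have "h (- w) = - h w"
    using h(1) linear_neg by (auto simp: vector_lattice_hom_def)
  then have "q w \<le> h w" using le_funD[OF h(2), of "- w"] q'(3) by simp
  moreover have "h \<le> q" using h(2) q'(2) by simp
  ultimately show thesis
    using that[OF h(1)] le_funD[of h q w] by simp
qed

section \<open>Homomorphisms on AM-spaces\<close>

lemma norm_mono_nonneg:
  fixes u v :: "'a::am_space"
  assumes "0 \<le> u" "u \<le> v"
  shows "norm u \<le> norm v"
  using assms by (intro norm_solid) (metis abs_of_nonneg order_trans)

lemma norm_abs_am_space [simp]: "norm \<bar>u\<bar> = norm (u :: 'a::am_space)"
  by (intro antisym norm_solid) auto

text \<open>The AM identity enters through the suprema: the positive part of \<open>sup u v\<close>
  is the supremum of the positive parts.\<close>

lemma sublinear_sup_hom_norm_pprt: "sublinear_sup_hom (\<lambda>u :: 'a::am_space. norm (sup u 0))"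
  unfolding sublinear_sup_hom_def
proof (intro conjI allI impI)
  fix u v :: 'a
  have "u + v \<le> sup u 0 + sup v 0" "0 \<le> sup u 0 + sup v 0"
    by (simp_all add: add_mono)
  then have "norm (sup (u + v) 0) \<le> norm (sup u 0 + sup v 0)"
    by (intro norm_mono_nonneg) auto
  also have "\<dots> \<le> norm (sup u 0) + norm (sup v 0)" by (rule norm_triangle_ineq)
  finally show "norm (sup (u + v) 0) \<le> norm (sup u 0) + norm (sup v 0)" .
  have "sup (sup u v) 0 = sup (sup u 0) (sup v 0)"
    by (simp add: sup_aci)
  then show "norm (sup (sup u v) 0) = max (norm (sup u 0)) (norm (sup v 0))"
    by (simp add: norm_sup_eq_max)
next
  fix c :: real and u :: 'a assume c: "c > 0"
  have le: "sup (c *\<^sub>R u) 0 \<le> c *\<^sub>R sup u 0" if "c > 0" for c and u :: 'a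
    using that by (intro sup_least scaleR_left_mono scaleR_nonneg_nonneg) auto
  have "norm (sup (c *\<^sub>R u) 0) \<le> c * norm (sup u 0)" if "c > 0" for c and u :: 'a
    using norm_mono_nonneg[OF _ le[OF that, of u]] that by simp
  from this[OF c, of u] this[of "inverse c" "c *\<^sub>R u"]
  show "norm (sup (c *\<^sub>R u) 0) = c * norm (sup u 0)"
    using c by (simp add: field_simps)
qed

lemma vector_lattice_homD:
  fixes h :: "'a::{ordered_real_vector,lattice_ab_group_add_abs} \<Rightarrow> real"
  assumes "vector_lattice_hom h"
  shows "linear h" "h (sup u v) = max (h u) (h v)" "h \<bar>u\<bar> = \<bar>h u\<bar>" "u \<le> v \<Longrightarrow> h u \<le> h v"
proof -
  show "linear h" and sup: "h (sup u v) = max (h u) (h v)" for u v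
    using assms by (auto simp: vector_lattice_hom_def sup_max)
  then show "h \<bar>u\<bar> = \<bar>h u\<bar>"
    by (simp add: abs_lattice linear_neg sup_max)
  show "h u \<le> h v" if "u \<le> v"
    using sup[of u v] that by (simp add: sup_absorb2 max_def split: if_splits)
qed

lemma vector_lattice_hom_dual_of_hom: "vector_lattice_hom (blinfun_apply (dual_of_hom x))"
  using dual_of_hom[of x] by simp

text \<open>Attainment at \<open>\<bar>u\<bar>\<close> even yields
  \<open>\<bar>h u\<bar> = norm u\<close>; automatic continuity then places \<open>h\<close> in the
  dual space.\<close>

lemma hom_space_separates:
  fixes u :: "'a::am_space"
  assumes "u \<noteq> 0"
  obtains x :: "'a hom_space" where "hom_eval u x \<noteq> 0"
proof -
  obtain h :: "'a \<Rightarrow> real" where h: "vector_lattice_hom h" "h \<bar>u\<bar> = norm (sup \<bar>u\<bar> 0)"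
    using vector_lattice_hom_below_sublinear_attaining[OF sublinear_sup_hom_norm_pprt] by blast
  then have "\<bar>h u\<bar> = norm u"
    using vector_lattice_homD(3)[OF h(1), of u] by (simp add: sup_absorb1)
  then have "h u \<noteq> 0"
    using assms by (metis abs_zero norm_eq_zero)
  moreover obtain x :: "'a hom_space" where "h = blinfun_apply (dual_of_hom x)"
    using h(1) range_apply_hom_space by (metis (mono_tags, lifting) imageE mem_Collect_eq)
  ultimately show thesis using that by (simp add: hom_eval_def)
qed

section \<open>The evaluation embedding\<close>

lemma vector_lattice_hom_hom_eval:
  "vector_lattice_hom (hom_eval :: 'a::am_space \<Rightarrow> 'a hom_space \<Rightarrow> real)"
  using vector_lattice_hom_dual_of_hom
  by (auto simp: vector_lattice_hom_def hom_eval_def linear_iff fun_eq_iff scaleR_fun_def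
      sup_fun_def inf_fun_def)

lemma inj_hom_eval: "inj (hom_eval :: 'a::am_space \<Rightarrow> 'a hom_space \<Rightarrow> real)"
proof (rule injI, rule ccontr)
  fix u v :: 'a assume eq: "(hom_eval u :: 'a hom_space \<Rightarrow> real) = hom_eval v" and "u \<noteq> v"
  then obtain x :: "'a hom_space" where "hom_eval (u - v) x \<noteq> 0"
    using hom_space_separates[of "u - v"] by auto
  moreover have "hom_eval (u - v) x = hom_eval u x - hom_eval v x"
    by (simp add: hom_eval_def blinfun.diff_right)
  ultimately show False using eq by simp
qed

lemma vector_sublattice_range:
  assumes "vector_lattice_hom h"
  shows "vector_sublattice (range h)"
proof -
  have "linear h" "\<And>u v. sup (h u) (h v) = h (sup u v)" "\<And>u v. inf (h u) (h v) = h (inf u v)"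
    using assms by (auto simp: vector_lattice_hom_def)
  then show ?thesis
    by (auto simp: vector_sublattice_def intro: linear_subspace_image[OF _ subspace_UNIV])
qed

section \<open>The bounded weak* topology\<close>

text \<open>The ball is the image under \<open>Blinfun\<close> of the linear functions in a product
  of compact intervals. These form a closed, hence compact set, and \<open>Blinfun\<close> is
  continuous on it because the weak* topology is pointwise.\<close>

theorem Banach_Alaoglu:
  fixes x :: "'a::real_normed_vector \<Rightarrow>\<^sub>L real"
  shows "compactin weak_star_topology (cball x r)"
\<comment> \<open>For \<open>r < 0\<close> the ball is empty; otherwise \<open>r\<close> can bound
  an operator norm.\<close>
proof (cases "r < 0")
  case False
  define K where "K = (\<Pi>\<^sub>E u\<in>UNIV. cball (x u) (r * norm u))"
  define S where "S = K \<inter> {h :: 'a \<Rightarrow> real. (\<forall>u v. h (u + v) = h u + h v) \<and> (\<forall>c u. h (c *\<^sub>R u) = c * h u)}"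
  have coord: "continuous_on UNIV (\<lambda>h :: 'a \<Rightarrow> real. h u)" for u
    by (rule continuous_on_product_coordinates)
  have "compactin (product_topology (\<lambda>i. euclidean) UNIV) K"
    unfolding K_def compactin_PiE by simp
  then have "compact K"
    by (simp add: euclidean_product_topology)
  moreover have "closed {h :: 'a \<Rightarrow> real. (\<forall>u v. h (u + v) = h u + h v) \<and> (\<forall>c u. h (c *\<^sub>R u) = c * h u)}"
    by (intro closed_Collect_conj closed_Collect_all closed_Collect_eq continuous_intros coord)
  ultimately have "compact S"
    unfolding S_def by (rule compact_Int_closed)
  have app: "blinfun_apply (Blinfun h) = h" and mem: "Blinfun h \<in> cball x r" if "h \<in> S" for h
  proof -
    have lin: "linear h" using that by (intro linearI) (auto simp: S_def)
    have bd: "\<bar>h u - x u\<bar> \<le> r * norm u" for u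
      using that by (auto simp: S_def K_def PiE_iff dist_real_def abs_minus_commute)
    have "norm (h u) \<le> norm u * (r + norm x)" for u
      using bd[of u] norm_blinfun[of x u] by (simp add: algebra_simps)
    then have "bounded_linear h"
      using lin by (auto simp: bounded_linear_def bounded_linear_axioms_def)
    then show app: "blinfun_apply (Blinfun h) = h" by (rule bounded_linear_Blinfun_apply)
    have "norm (Blinfun h - x) \<le> r"
      using False bd by (intro norm_blinfun_bound) (auto simp: blinfun.diff_left app)
    then show "Blinfun h \<in> cball x r" by (simp add: dist_norm norm_minus_commute)
  qed
  have "continuous_map (top_of_set S) weak_star_topology Blinfun"
    unfolding continuous_on_strong_operator_topo_iff_coordinatewise
  proof
    fix u
    have "continuous_on S (\<lambda>h. h u)" using coord continuous_on_subset by blast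
    then show "continuous_map (top_of_set S) euclidean (\<lambda>h. blinfun_apply (Blinfun h) u)"
      by (simp add: app cong: continuous_on_cong)
  qed
  then have "compactin weak_star_topology (Blinfun ` S)"
    using \<open>compact S\<close> by (intro image_compactin[of "top_of_set S"]) (auto simp: compactin_subtopology)
  moreover have "cball x r \<subseteq> Blinfun ` S"
  proof
    fix z assume z: "z \<in> cball x r"
    have "\<bar>z u - x u\<bar> \<le> r * norm u" for u
      using norm_blinfun[of "z - x" u] z mult_right_mono[of "norm (z - x)" r "norm u"]
      by (simp add: dist_norm norm_minus_commute blinfun.diff_left)
    then have "blinfun_apply z \<in> S"
      by (auto simp: S_def K_def PiE_iff dist_real_def abs_minus_commute blinfun.add_right blinfun.scaleR_right)
    then show "z \<in> Blinfun ` S"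
      by (metis blinfun_apply_inverse imageI)
  qed
  ultimately show ?thesis
    using mem by (metis image_subsetI subset_antisym)
qed simp

section \<open>Neighbourhoods in the bounded weak* topology\<close>

lemma openin_weak_star_apply:
  assumes "open S"
  shows "openin weak_star_topology {x. blinfun_apply x a \<in> S}"
  using openin_continuous_map_preimage[OF strong_operator_topology_continuous_evaluation, of S a] assms
  by (simp add: strong_operator_topology_topspace)

lemma openin_bounded_weak_star_if_weak_star:
  assumes "openin weak_star_topology U"
  shows "openin bounded_weak_star_topology U"
  using assms unfolding openin_bounded_weak_star_topology openin_subtopology by blast

text \<open>
  The conditions \<open>\<bar>x a - y a\<bar> \<le> 1\<close> for all \<open>a\<close> with \<open>R1 * norm a \<le> 1\<close> together confine \<open>x\<close> to the
  smaller ball, hence to \<open>V\<close>; compactness of the larger ball leaves finitely many of them.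
\<close>
lemma Banach_Dieudonne_step:
  fixes V :: "('a::real_normed_vector \<Rightarrow>\<^sub>L real) set" and y :: "'a \<Rightarrow>\<^sub>L real"
  assumes V: "openin bounded_weak_star_topology V" and "finite S" and "0 \<le> R1"
    and sub: "\<And>x :: 'a \<Rightarrow>\<^sub>L real. dist y x \<le> R1 \<Longrightarrow> (\<forall>a\<in>S. \<bar>blinfun_apply x a - blinfun_apply y a\<bar> \<le> 1) \<Longrightarrow> x \<in> V"
  obtains A where "finite A" "\<And>a. a \<in> A \<Longrightarrow> R1 * norm a \<le> 1"
    "\<And>x :: 'a \<Rightarrow>\<^sub>L real. dist y x \<le> R2 \<Longrightarrow> (\<forall>a\<in>S \<union> A. \<bar>blinfun_apply x a - blinfun_apply y a\<bar> \<le> 1) \<Longrightarrow> x \<in> V"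
proof -
  define D where "D = {a :: 'a. R1 * norm a \<le> 1}"
  \<comment> \<open>The points violating the condition at \<open>a\<close>. Together with a weak*
    open \<open>W\<close> that cuts out \<open>V\<close> on the larger ball, these sets cover that
    ball.\<close>
  define O' where "O' a = {x. blinfun_apply x a \<in> {t. \<bar>t - blinfun_apply y a\<bar> > 1}}" for a
  have O': "openin weak_star_topology (O' a)" for a
    unfolding O'_def
    by (intro openin_weak_star_apply open_Collect_less continuous_intros)
  have "openin (subtopology weak_star_topology (cball y R2)) (V \<inter> cball y R2)"
    using V by (simp add: openin_bounded_weak_star_topology)
  then obtain W where W: "openin weak_star_topology W" "V \<inter> cball y R2 = W \<inter> cball y R2"
    by (auto simp: openin_subtopology)
  have cover: "cball y R2 \<subseteq> \<Union>(insert W (O' ` (S \<union> D)))"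
  proof
    fix x assume x: "x \<in> cball y R2"
    show "x \<in> \<Union>(insert W (O' ` (S \<union> D)))"
    proof (rule ccontr)
      assume n: "\<not> ?thesis"
      then have bd: "\<bar>blinfun_apply x a - blinfun_apply y a\<bar> \<le> 1" if "a \<in> S \<union> D" for a
        using that by (auto simp: O'_def not_less)
      have "norm ((x - y) a) \<le> R1 * norm a" for a
      proof (rule ccontr)
        assume gt: "\<not> ?thesis"
        define d where "d = \<bar>(x - y) a\<bar>"
        \<comment> \<open>The reciprocal of the midpoint of \<open>R1 * norm a\<close> and
          \<open>d\<close>: it scales \<open>a\<close> into \<open>D\<close>, while
          \<open>x - y\<close> still exceeds \<open>1\<close> in modulus on the multiple.\<close>
        define c where "c = 2 / (d + R1 * norm a)"
        have d: "R1 * norm a < d" "0 \<le> R1 * norm a" using gt \<open>0 \<le> R1\<close> by (auto simp: d_def)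
        then have c: "c > 0" "c * (R1 * norm a) \<le> 1" "c * d > 1"
          by (auto simp: c_def field_simps)
        have "R1 * norm (c *\<^sub>R a) \<le> 1" using c by (simp add: mult.left_commute)
        then have "\<bar>(x - y) (c *\<^sub>R a)\<bar> \<le> 1"
          using bd[of "c *\<^sub>R a"] by (simp add: D_def blinfun.diff_left)
        then have "c * d \<le> 1"
          using c(1) by (simp add: d_def blinfun.scaleR_right abs_mult)
        then show False using c(3) by simp
      qed
      then have "dist y x \<le> R1"
        using norm_blinfun_bound[OF \<open>0 \<le> R1\<close>, of "x - y"] by (simp add: dist_norm norm_minus_commute)
      then have "x \<in> V \<inter> cball y R2" using sub bd x by simp
      then show False using n unfolding W(2) by simp
    qed
  qed
  have "\<exists>\<F>. finite \<F> \<and> \<F> \<subseteq> insert W (O' ` (S \<union> D)) \<and> cball y R2 \<subseteq> \<Union>\<F>"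
    using W(1) O' by (intro compactinD[OF Banach_Alaoglu _ cover]) auto
  then obtain \<F> where \<F>: "finite \<F>" "\<F> \<subseteq> insert W (O' ` (S \<union> D))" "cball y R2 \<subseteq> \<Union>\<F>"
    by blast
  \<comment> \<open>Apart from \<open>W\<close>, the subcover comes from finitely many vectors
    \<open>G\<close>. Conditions from \<open>S\<close> are already imposed, so adjoining
    \<open>G \<inter> D\<close> suffices.\<close>
  then have "finite (\<F> - {W})" "\<F> - {W} \<subseteq> O' ` (S \<union> D)" by auto
  then obtain G where G: "G \<subseteq> S \<union> D" "finite G" "\<F> - {W} = O' ` G"
    using finite_subset_image by metis
  show thesis
  proof
    show "finite (G \<inter> D)" using G by simp
    show "R1 * norm a \<le> 1" if "a \<in> G \<inter> D" for a using that by (simp add: D_def)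
    fix x :: "'a \<Rightarrow>\<^sub>L real" assume x: "dist y x \<le> R2" "\<forall>a\<in>S \<union> G \<inter> D. \<bar>blinfun_apply x a - blinfun_apply y a\<bar> \<le> 1"
    have "x \<notin> O' a" if "a \<in> G" for a
    proof -
      have "a \<in> S \<union> G \<inter> D" using that G(1) by blast
      then show ?thesis using x(2) by (auto simp: O'_def not_less)
    qed
    then have "x \<notin> \<Union>(\<F> - {W})" unfolding G(3) by blast
    moreover have "x \<in> \<Union>\<F>" using x(1) \<F>(3) by auto
    ultimately have "x \<in> W" by blast
    then have "x \<in> W \<inter> cball y R2" using x(1) by simp
    then show "x \<in> V" unfolding W(2)[symmetric] by simp
  qed
qed

text \<open>Balls of radius \<open>n\<^sup>2\<close> exhaust the dual, and passing from one to the
  next costs finitely many vectors of norm at most \<open>1 / n\<^sup>2\<close> when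
  \<open>n > 0\<close>. Squares are chosen to make these bounds summable.\<close>

lemma Banach_Dieudonne:
  fixes V :: "('a::real_normed_vector \<Rightarrow>\<^sub>L real) set" and y :: "'a \<Rightarrow>\<^sub>L real"
  assumes V: "openin bounded_weak_star_topology V" and "y \<in> V"
  obtains A :: "nat \<Rightarrow> 'a set" where "\<And>n. finite (A n)" "\<And>n a. a \<in> A n \<Longrightarrow> (real n)\<^sup>2 * norm a \<le> 1"
    "\<And>x :: 'a \<Rightarrow>\<^sub>L real. (\<And>n a. a \<in> A n \<Longrightarrow> \<bar>blinfun_apply x a - blinfun_apply y a\<bar> \<le> 1) \<Longrightarrow> x \<in> V"
proof -
  define P where "P n S \<longleftrightarrow> finite S \<and>
    (\<forall>x :: 'a \<Rightarrow>\<^sub>L real. dist y x \<le> (real n)\<^sup>2 \<longrightarrow> (\<forall>a\<in>S. \<bar>blinfun_apply x a - blinfun_apply y a\<bar> \<le> 1) \<longrightarrow> x \<in> V)" for n and S :: "'a set"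
  define Q where "Q n S S' \<longleftrightarrow> (\<exists>A. finite A \<and> (\<forall>a\<in>A. (real n)\<^sup>2 * norm a \<le> 1) \<and> S' = S \<union> A)"
    for n and S S' :: "'a set"
  have "\<exists>S. \<forall>n. P n (S n) \<and> Q n (S n) (S (Suc n))"
  proof (rule dependent_nat_choice)
    \<comment> \<open>The ball of radius \<open>0\<close> contains only \<open>y\<close>, so the
      empty set of conditions works.\<close>
    show "\<exists>S. P 0 S"
      using \<open>y \<in> V\<close> by (intro exI[of _ "{}"]) (auto simp: P_def)
    fix S n assume "P n S"
    then obtain A where "finite A" "\<And>a. a \<in> A \<Longrightarrow> (real n)\<^sup>2 * norm a \<le> 1"
      "\<And>x :: 'a \<Rightarrow>\<^sub>L real. dist y x \<le> (real (Suc n))\<^sup>2 \<Longrightarrow> (\<forall>a\<in>S \<union> A. \<bar>blinfun_apply x a - blinfun_apply y a\<bar> \<le> 1) \<Longrightarrow> x \<in> V"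
      using Banach_Dieudonne_step[OF V, of S "(real n)\<^sup>2" y "(real (Suc n))\<^sup>2"]
      unfolding P_def by (metis zero_le_power2)
    then show "\<exists>S'. P (Suc n) S' \<and> Q n S S'"
      using \<open>P n S\<close> unfolding P_def Q_def by (intro exI[of _ "S \<union> A"]) auto
  qed
  then obtain S where P: "\<And>n. P n (S n)" and Q: "\<And>n. Q n (S n) (S (Suc n))" by blast
  then obtain A where A: "\<And>n. finite (A n)" "\<And>n a. a \<in> A n \<Longrightarrow> (real n)\<^sup>2 * norm a \<le> 1"
    "\<And>n. S (Suc n) = S n \<union> A n"
    unfolding Q_def by metis
  show thesis
  \<comment> \<open>\<open>S 0\<close> comes without a norm bound; it goes into index
    \<open>0\<close>, where the required bound is void.\<close>
  proof (rule that[of "\<lambda>n. if n = 0 then S 0 \<union> A 0 else A n"])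
    show "finite (if n = 0 then S 0 \<union> A 0 else A n)" for n
      using A(1) P[of 0] by (simp add: P_def)
    show "(real n)\<^sup>2 * norm a \<le> 1" if "a \<in> (if n = 0 then S 0 \<union> A 0 else A n)" for n a
      using that A(2) by (auto split: if_splits)
    fix x :: "'a \<Rightarrow>\<^sub>L real" assume x: "\<And>n a. a \<in> (if n = 0 then S 0 \<union> A 0 else A n) \<Longrightarrow> \<bar>blinfun_apply x a - blinfun_apply y a\<bar> \<le> 1"
    have "\<forall>a\<in>S n. \<bar>blinfun_apply x a - blinfun_apply y a\<bar> \<le> 1" for n
    proof (induction n)
      case 0
      then show ?case using x[of _ 0] by auto
    next
      case (Suc n)
      then show ?case using x[of _ n] by (cases "n = 0") (auto simp: A(3))
    qed
    moreover obtain n where "dist y x \<le> real n" using real_arch_simple by blast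
    then have "dist y x \<le> (real n)\<^sup>2"
      by (rule order_trans) (simp add: power2_eq_square flip: of_nat_mult)
    ultimately show "x \<in> V" using P[of n] by (auto simp: P_def)
  qed
qed

lemma continuous_hom_eval: "continuous_on UNIV (hom_eval u :: 'a::am_space hom_space \<Rightarrow> real)"
  unfolding continuous_on_open_vimage[OF open_UNIV]
proof (intro allI impI)
  fix B :: "real set" assume "open B"
  then have "openin bounded_weak_star_topology {x. blinfun_apply x u \<in> B}"
    by (intro openin_bounded_weak_star_if_weak_star openin_weak_star_apply)
  moreover have "hom_eval u -` B = dual_of_hom -` {x. blinfun_apply x u \<in> B}"
    by (auto simp: hom_eval_def)
  ultimately show "open (hom_eval u -` B \<inter> UNIV)"
    unfolding open_hom_space_def openin_pullback_topology by auto
qed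

section \<open>Regularity\<close>

text \<open>Used to normalise a homomorphism to the value \<open>1\<close> at a given vector.
  Nonnegative factors commute with \<open>max\<close> and \<open>min\<close>.\<close>

lemma ex_scaled_hom:
  fixes x :: "'a::am_space hom_space"
  assumes "0 \<le> c"
  obtains z where "dual_of_hom z = c *\<^sub>R dual_of_hom x" "\<And>u. hom_eval u z = c * hom_eval u x"
proof -
  have "vector_lattice_hom (blinfun_apply (c *\<^sub>R dual_of_hom x))"
    using vector_lattice_hom_dual_of_hom[of x] assms
    by (auto simp: vector_lattice_hom_def linear_iff blinfun.scaleR_left algebra_simps
        sup_max inf_min max_mult_distrib_left min_mult_distrib_left)
  then have "dual_of_hom (hom_of_dual (c *\<^sub>R dual_of_hom x)) = c *\<^sub>R dual_of_hom x"
    by (simp add: hom_of_dual_inverse)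
  then show thesis
    using that by (simp add: hom_eval_def blinfun.scaleR_left)
qed

text \<open>The finite supremum with \<open>0\<close> works: by the AM identity its norm is the
  largest norm in \<open>B\<close>, so the bound does not grow with the size of \<open>B\<close>.
  The product form of the bound also covers \<open>k = 0\<close>.\<close>

lemma ex_finite_upper_bound:
  fixes B :: "'a::am_space set"
  assumes "finite B" "\<And>b. b \<in> B \<Longrightarrow> 0 \<le> b" "\<And>b. b \<in> B \<Longrightarrow> k * norm b \<le> c" "0 \<le> c"
  obtains v where "0 \<le> v" "k * norm v \<le> c" "\<And>b. b \<in> B \<Longrightarrow> b \<le> v"
    "\<And>h :: 'a \<Rightarrow> real. vector_lattice_hom h \<Longrightarrow> (\<And>b. b \<in> B \<Longrightarrow> h b = 0) \<Longrightarrow> h v = 0"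
proof -
  have "\<exists>v\<ge>0. k * norm v \<le> c \<and> (\<forall>b\<in>B. b \<le> v) \<and>
      (\<forall>h :: 'a \<Rightarrow> real. vector_lattice_hom h \<longrightarrow> (\<forall>b\<in>B. h b = 0) \<longrightarrow> h v = 0)"
    using assms
  proof (induction B rule: finite_induct)
    case empty
    then show ?case
      by (intro exI[of _ 0]) (auto simp: linear_0 vector_lattice_homD(1))
  next
    case (insert b B)
    then obtain v where v: "0 \<le> v" "k * norm v \<le> c" "\<forall>b\<in>B. b \<le> v"
      "\<forall>h :: 'a \<Rightarrow> real. vector_lattice_hom h \<longrightarrow> (\<forall>b\<in>B. h b = 0) \<longrightarrow> h v = 0"
      by auto
    have "norm (sup b v) = max (norm b) (norm v)"
      using insert.prems(1) v(1) by (intro norm_sup_eq_max) auto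
    then show ?case
      using v insert.prems
      by (intro exI[of _ "sup b v"]) (auto simp: vector_lattice_homD(2) max_def le_supI2)
  qed
  then show thesis using that by blast
qed

lemma am_space_le_suminf:
  fixes v :: "nat \<Rightarrow> 'a::am_space"
  assumes "summable v" "\<And>n. 0 \<le> v n"
  shows "v n \<le> suminf v"
proof -
  have "(\<lambda>m. (\<Sum>i<m. v i) - v n) \<longlonglongrightarrow> suminf v - v n"
    by (intro tendsto_intros summable_LIMSEQ assms)
  moreover have "0 \<le> (\<Sum>i<m. v i) - v n" if "m \<ge> Suc n" for m
    using sum_mono2[of "{..<m}" "{n}" v] that assms(2) by auto
  ultimately have "0 \<le> suminf v - v n" by (rule am_space_nonneg_limit)
  then show ?thesis by simp
qed

text \<open>A substitute for Urysohn functions: evaluations are homogeneous, so positivity of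
  \<open>f\<close> can only be confined to the cone over the slice of \<open>U\<close> where
  \<open>e\<close> takes the value \<open>1\<close>.\<close>

lemma ex_conical_bump:
  fixes U :: "'a::am_space hom_space set"
  assumes "open U" "y \<in> U" and e: "0 \<le> e" "hom_eval e y = 1"
  obtains f where "0 \<le> f" "f \<le> e" "hom_eval f y = 1"
    "\<And>x. hom_eval f x > 0 \<Longrightarrow> \<exists>z\<in>U. \<forall>u. hom_eval u x = hom_eval e x * hom_eval u z"
proof -
  note hD = vector_lattice_homD[OF vector_lattice_hom_dual_of_hom]
  obtain V where V: "openin bounded_weak_star_topology V" "U = dual_of_hom -` V"
    using \<open>open U\<close> unfolding open_hom_space_def openin_pullback_topology by auto
  define y' where "y' = dual_of_hom y"
  have y'e: "y' e = 1" using e(2) by (simp add: y'_def hom_eval_def)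
  have "y' \<in> V" using V(2) \<open>y \<in> U\<close> by (simp add: y'_def)
  then obtain A :: "nat \<Rightarrow> 'a set" where A: "\<And>n. finite (A n)"
    "\<And>n a. a \<in> A n \<Longrightarrow> (real n)\<^sup>2 * norm a \<le> 1"
    "\<And>x :: 'a \<Rightarrow>\<^sub>L real. (\<And>n a. a \<in> A n \<Longrightarrow> \<bar>blinfun_apply x a - y' a\<bar> \<le> 1) \<Longrightarrow> x \<in> V"
    using Banach_Dieudonne[OF V(1)] by blast
  \<comment> \<open>At a homomorphism normalised to \<open>1\<close> at \<open>e\<close>, this
    evaluates to its deviation from \<open>y'\<close> at \<open>a\<close>; at \<open>y'\<close> it
    vanishes.\<close>
  define \<beta> where "\<beta> a = \<bar>a - y' a *\<^sub>R e\<bar>" for a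
  define M where "M = 1 + norm y' * norm e"
  have M: "0 \<le> M" by (simp add: M_def)
  have norm_\<beta>: "(real n)\<^sup>2 * norm (\<beta> a) \<le> M" if "a \<in> A n" for n a
  proof -
    have "norm (\<beta> a) \<le> norm a + \<bar>y' a\<bar> * norm e"
      unfolding \<beta>_def using norm_triangle_ineq4[of a "y' a *\<^sub>R e"] by simp
    also have "\<dots> \<le> norm a + (norm y' * norm a) * norm e"
      using norm_blinfun[of y' a] by (intro add_left_mono mult_right_mono) auto
    also have "\<dots> = norm a * M" by (simp add: M_def algebra_simps)
    finally have "(real n)\<^sup>2 * norm (\<beta> a) \<le> ((real n)\<^sup>2 * norm a) * M"
      by (simp add: mult_left_mono mult.assoc)
    also have "\<dots> \<le> 1 * M" using A(2)[OF that] M by (intro mult_right_mono)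
    finally show ?thesis by simp
  qed
  have "\<exists>v\<ge>0. (real n)\<^sup>2 * norm v \<le> M \<and> (\<forall>a\<in>A n. \<beta> a \<le> v) \<and>
      (\<forall>h :: 'a \<Rightarrow> real. vector_lattice_hom h \<longrightarrow> (\<forall>a\<in>A n. h (\<beta> a) = 0) \<longrightarrow> h v = 0)" for n
  proof -
    obtain w where w: "0 \<le> w" "(real n)\<^sup>2 * norm w \<le> M" "\<And>b. b \<in> \<beta> ` A n \<Longrightarrow> b \<le> w"
      "\<And>h :: 'a \<Rightarrow> real. vector_lattice_hom h \<Longrightarrow> (\<And>b. b \<in> \<beta> ` A n \<Longrightarrow> h b = 0) \<Longrightarrow> h w = 0"
    proof (rule ex_finite_upper_bound[of "\<beta> ` A n" "(real n)\<^sup>2" M])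
      show "0 \<le> b" if "b \<in> \<beta> ` A n" for b
        using that by (auto simp: \<beta>_def)
    qed (use A(1) norm_\<beta> M in auto)
    then show ?thesis by (intro exI[of _ w]) auto
  qed
  then obtain v where v: "\<And>n. 0 \<le> v n" "\<And>n. (real n)\<^sup>2 * norm (v n) \<le> M"
    "\<And>n a. a \<in> A n \<Longrightarrow> \<beta> a \<le> v n"
    "\<And>n (h :: 'a \<Rightarrow> real). vector_lattice_hom h \<Longrightarrow> (\<forall>a\<in>A n. h (\<beta> a) = 0) \<Longrightarrow> h (v n) = 0"
    by metis
  have "summable v"
  proof (rule summable_comparison_test)
    \<comment> \<open>The comparison starts at \<open>n = 1\<close>, since at \<open>n = 0\<close>
      the bound on \<open>v\<close> is void and \<open>inverse 0 = 0\<close>.\<close>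
    show "\<exists>N. \<forall>n\<ge>N. norm (v n) \<le> M * inverse ((real n)\<^sup>2)"
      using v(2) by (intro exI[of _ 1]) (auto simp: field_simps)
    show "summable (\<lambda>n. M * inverse ((real n)\<^sup>2))"
      by (intro summable_mult inverse_power_summable) auto
  qed
  define s where "s = suminf v"
  have vs: "v n \<le> s" for n
    unfolding s_def using \<open>summable v\<close> v(1) by (rule am_space_le_suminf)
  then have s0: "0 \<le> s" using v(1)[of 0] order_trans by blast
  have "y' (\<beta> a) = 0" for a
    unfolding \<beta>_def y'_def hD(3)
    by (simp add: y'e[unfolded y'_def] blinfun.diff_right blinfun.scaleR_right)
  then have "y' (v n) = 0" for n
    using v(4)[OF vector_lattice_hom_dual_of_hom] by (simp add: y'_def)
  \<comment> \<open>Continuity of \<open>y'\<close> lets it pass through the series.\<close>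
  then have y's: "y' s = 0"
    unfolding s_def using bounded_linear.suminf[OF blinfun.bounded_linear_right \<open>summable v\<close>, of y']
    by simp
  show thesis
  proof
    show "0 \<le> sup (e - s) 0" "sup (e - s) 0 \<le> e" using e(1) s0 by auto
    have eval: "hom_eval (sup (e - s) 0) x = max (hom_eval e x - hom_eval s x) 0" for x :: "'a hom_space"
      by (simp add: hom_eval_def hD(2) blinfun.diff_right blinfun.zero_right)
    show "hom_eval (sup (e - s) 0) y = 1"
      using e(2) y's by (simp add: eval) (simp add: hom_eval_def y'_def)
    fix x :: "'a hom_space" assume "hom_eval (sup (e - s) 0) x > 0"
    then have less: "hom_eval s x < hom_eval e x" by (simp add: eval)
    moreover have "0 \<le> hom_eval s x"
      using hD(4)[OF s0, of x] by (simp add: hom_eval_def blinfun.zero_right)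
    ultimately have ex: "hom_eval e x > 0" by simp
    \<comment> \<open>The point where the ray through \<open>x\<close> meets the slice
      \<open>e = 1\<close>. There \<open>s\<close> is below \<open>1\<close> and dominates every
      deviation, so all conditions from \<open>A\<close> hold.\<close>
    obtain z where z: "dual_of_hom z = inverse (hom_eval e x) *\<^sub>R dual_of_hom x"
      "\<And>u. hom_eval u z = inverse (hom_eval e x) * hom_eval u x"
      using ex_scaled_hom[of "inverse (hom_eval e x)" x] ex by auto
    have "dual_of_hom z \<in> V"
    proof (rule A(3))
      fix n a assume a: "a \<in> A n"
      have "\<bar>hom_eval a x - y' a * hom_eval e x\<bar> = hom_eval (\<beta> a) x"
        by (simp add: hom_eval_def \<beta>_def hD(3) blinfun.diff_right blinfun.scaleR_right)
      also have "\<dots> \<le> hom_eval s x"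
        unfolding hom_eval_def using v(3)[OF a] vs[of n] by (intro hD(4)) auto
      finally have "\<bar>hom_eval a x - y' a * hom_eval e x\<bar> \<le> hom_eval e x"
        using less by simp
      then have "\<bar>hom_eval a x / hom_eval e x - y' a\<bar> \<le> 1"
        using ex by (simp add: abs_le_iff field_simps)
      then show "\<bar>dual_of_hom z a - y' a\<bar> \<le> 1"
        using z(2)[of a] by (simp add: hom_eval_def divide_inverse mult.commute)
    qed
    then show "\<exists>z\<in>U. \<forall>u. hom_eval u x = hom_eval e x * hom_eval u z"
      using V(2) z(2) ex by (intro bexI[of _ z]) auto
  qed
qed

section \<open>Comparison of continuous lower bounds with bumps\<close>

lemma regular_sublattice_hom_eval:
  "regular_sublattice (range (hom_eval :: 'a::am_space \<Rightarrow> 'a hom_space \<Rightarrow> real)) real_continuous_functions"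
  unfolding regular_sublattice_def
proof (intro conjI allI impI)
  show "range (hom_eval :: 'a \<Rightarrow> 'a hom_space \<Rightarrow> real) \<subseteq> real_continuous_functions"
    using continuous_hom_eval by (auto simp: real_continuous_functions_def)
  show "vector_sublattice (range (hom_eval :: 'a \<Rightarrow> 'a hom_space \<Rightarrow> real))"
    by (rule vector_sublattice_range[OF vector_lattice_hom_hom_eval])
  fix P :: "('a hom_space \<Rightarrow> real) set"
  assume P: "P \<subseteq> range hom_eval" "P \<noteq> {}" and glb: "isGlb (range hom_eval) P 0"
  have P0: "0 \<le> p" if "p \<in> P" for p
    using glb that by (auto dest: isGlbD2 simp: isGlb_def greatestP_def isLb_def setge_def)
  have greatest: "f \<le> 0" if "f \<in> range hom_eval" "\<And>p. p \<in> P \<Longrightarrow> f \<le> p" for f :: "'a hom_space \<Rightarrow> real"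
    using glb that by (auto simp: isGlb_def greatestP_def isLb_def setge_def setle_def)
  have "g \<le> 0" if g: "g \<in> real_continuous_functions" "\<And>p. p \<in> P \<Longrightarrow> g \<le> p" for g
  proof (rule ccontr)
    assume "\<not> g \<le> 0"
    then obtain y where y: "g y > 0" by (auto simp: le_fun_def not_le)
    \<comment> \<open>A member of \<open>P\<close> lies above \<open>g\<close>, hence is positive at
      \<open>y\<close>; it supplies the normalising vector \<open>e\<close>.\<close>
    obtain u0 where "hom_eval u0 \<in> P" using P by blast
    then have "hom_eval u0 y > 0" using g(2) y by (metis le_funD less_le_trans)
    define e where "e = inverse (hom_eval u0 y) *\<^sub>R sup u0 0"
    have e: "0 \<le> e" "hom_eval e y = 1"
      using \<open>hom_eval u0 y > 0\<close> vector_lattice_homD(2)[OF vector_lattice_hom_dual_of_hom, of y u0 0]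
      by (auto simp: e_def hom_eval_def blinfun.scaleR_right blinfun.zero_right
          intro!: scaleR_nonneg_nonneg)
    \<comment> \<open>Half of \<open>g y\<close> leaves \<open>y\<close> inside the strict
      superlevel set \<open>U\<close>.\<close>
    define \<epsilon> where "\<epsilon> = g y / 2"
    define U where "U = {x. \<epsilon> < g x}"
    have "open U"
      unfolding U_def using g(1)
      by (intro open_Collect_less continuous_intros) (auto simp: real_continuous_functions_def)
    moreover have "y \<in> U" using y by (simp add: U_def \<epsilon>_def)
    ultimately obtain f where f: "0 \<le> f" "f \<le> e" "hom_eval f y = 1"
      "\<And>x. hom_eval f x > 0 \<Longrightarrow> \<exists>z\<in>U. \<forall>u. hom_eval u x = hom_eval e x * hom_eval u z"
      using ex_conical_bump[OF _ _ e] by blast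
    have "hom_eval (\<epsilon> *\<^sub>R f) \<le> p" if p: "p \<in> P" for p
    proof (rule le_funI)
      fix x
      obtain u where u: "p = hom_eval u" using p P by blast
      have fx: "hom_eval (\<epsilon> *\<^sub>R f) x = \<epsilon> * hom_eval f x"
        by (simp add: hom_eval_def blinfun.scaleR_right)
      have fe: "hom_eval f x \<le> hom_eval e x"
        unfolding hom_eval_def
        by (rule vector_lattice_homD(4)[OF vector_lattice_hom_dual_of_hom f(2)])
      show "hom_eval (\<epsilon> *\<^sub>R f) x \<le> p x"
      proof (cases "hom_eval f x > 0")
        case True
        then obtain z where z: "z \<in> U" "hom_eval u x = hom_eval e x * hom_eval u z"
          using f(4) by blast
        \<comment> \<open>On \<open>U\<close> each \<open>p\<close> exceeds
          \<open>\<epsilon>\<close>; homogeneity carries this from \<open>z\<close> to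
          \<open>x\<close>, with the factor \<open>hom_eval e x\<close>, which dominates
          \<open>hom_eval f x\<close>.\<close>
        have "\<epsilon> * hom_eval f x \<le> \<epsilon> * hom_eval e x"
          using fe y by (intro mult_left_mono) (auto simp: \<epsilon>_def)
        also have "\<dots> \<le> hom_eval u z * hom_eval e x"
          using z(1) True fe le_funD[OF g(2)[OF p], of z]
          by (intro mult_right_mono) (auto simp: U_def u)
        finally show ?thesis using z(2) u fx by (simp add: mult.commute)
      next
        case False
        then have "\<epsilon> * hom_eval f x \<le> 0" using y by (simp add: \<epsilon>_def mult_le_0_iff)
        also have "0 \<le> p x" using le_funD[OF P0[OF p], of x] by simp
        finally show ?thesis by (simp add: fx)
      qed
    qed
    \<comment> \<open>The bump is a lower bound of \<open>P\<close> inside the sublattice, where the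
      infimum is known to be \<open>0\<close>; its value at \<open>y\<close> is
      \<open>\<epsilon> > 0\<close>.\<close>
    then have "hom_eval (\<epsilon> *\<^sub>R f) \<le> (0 :: 'a hom_space \<Rightarrow> real)" by (intro greatest) auto
    then have "hom_eval (\<epsilon> *\<^sub>R f) y \<le> 0" using le_funD by fastforce
    then show False
      using f(3) y by (simp add: hom_eval_def blinfun.scaleR_right \<epsilon>_def)
  qed
  moreover have "0 \<in> real_continuous_functions"
    by (simp add: real_continuous_functions_def zero_fun_def)
  ultimately show "isGlb real_continuous_functions P 0"
    using P0 by (auto simp: isGlb_def greatestP_def isLb_def setge_def setle_def)
qed

theorem theorem7p9:
  shows "vector_lattice_hom (hom_eval :: 'a::am_space \<Rightarrow> 'a hom_space \<Rightarrow> real) \<and>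
    inj (hom_eval :: 'a \<Rightarrow> 'a hom_space \<Rightarrow> real) \<and>
    regular_sublattice (range (hom_eval :: 'a \<Rightarrow> 'a hom_space \<Rightarrow> real)) real_continuous_functions"
  by (intro conjI vector_lattice_hom_hom_eval inj_hom_eval regular_sublattice_hom_eval)

end
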